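(* Let $I=[-1,1]$ and let $\alpha\ge 1$ be an integer. If $\psi\in C^\alpha(I)$ is real-valued, then $m_\psi(\lambda)=O(\log\lambda)$ as $\lambda\to\infty$. This bound is sharp: there exists a real-valued $\psi\in C^\alpha(I)$ such that $|m_\psi(\lambda)|\approx\log\lambda$ for all sufficiently large $\lambda$.
   Context: For a real-valued $\psi\in C^1(I)$, $I=[-1,1]$, and $\lambda>0$, the Stein--Wainger oscillatory integral is $m_\psi(\lambda):=\mathrm{p.v.}\int_{-1}^{1}e^{i\lambda\psi(t)}\frac{dt}{t}=\lim_{\varepsilon\to0^+}\int_{\varepsilon\le|t|\le1}e^{i\lambda\psi(t)}\frac{dt}{t}$. Implicit constants may depend on $\psi$ and $\alpha$ but not on $\lambda$. $X\approx Y$ means $cY\le X\le CY$ for some constants $c,C>0$ independent of $\lambda$. *)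

theory Defs
  imports "HOL-Analysis.Analysis" "HOL-Library.Landau_Symbols"
begin

(* D j is the j-th derivative of f on S; derivatives are relative to S, hence one-sided
   at the endpoints of a compact interval.  Values of f outside S are irrelevant. *)
definition C_diff_on :: "nat \<Rightarrow> (real \<Rightarrow> real) \<Rightarrow> real set \<Rightarrow> bool" where
  "C_diff_on k f S \<longleftrightarrow>
     (\<exists>D :: nat \<Rightarrow> real \<Rightarrow> real. D 0 = f \<and>
        (\<forall>j<k. \<forall>x\<in>S. (D j has_real_derivative D (Suc j) x) (at x within S)) \<and>
        (\<forall>j\<le>k. continuous_on S (D j)))"

definition truncated_SW :: "(real \<Rightarrow> real) \<Rightarrow> real \<Rightarrow> real \<Rightarrow> complex" where
  "truncated_SW \<psi> lam \<epsilon> =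
     integral {t. \<epsilon> \<le> \<bar>t\<bar> \<and> \<bar>t\<bar> \<le> 1}
       (\<lambda>t. exp (\<i> * complex_of_real (lam * \<psi> t)) / complex_of_real t)"

(* The limit exists for every C^1 phase: see SW_limit_exists. *)
definition SW_integral :: "(real \<Rightarrow> real) \<Rightarrow> real \<Rightarrow> complex" where
  "SW_integral \<psi> lam = Lim (at_right 0) (truncated_SW \<psi> lam)"

lemma C_diff_on_mono: "C_diff_on k f S \<Longrightarrow> j \<le> k \<Longrightarrow> C_diff_on j f S"
  unfolding C_diff_on_def
  by (elim exE conjE, rule exI, intro conjI, assumption) auto

lemma SW_region:
  assumes "0 < (\<epsilon>::real)"
  shows "{t. \<epsilon> \<le> \<bar>t\<bar> \<and> \<bar>t\<bar> \<le> 1} = {-1..-\<epsilon>} \<union> {\<epsilon>..1}"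
  using assms by (auto simp: abs_if split: if_splits)

lemma truncated_SW_has_integral:
  fixes lam :: real
  assumes cont: "continuous_on {-1..1} \<psi>" and \<epsilon>: "0 < \<epsilon>" "\<epsilon> \<le> 1"
  defines "e \<equiv> \<lambda>t. exp (\<i> * complex_of_real (lam * \<psi> t))"
  shows "((\<lambda>t. e t / complex_of_real t) has_integral truncated_SW \<psi> lam \<epsilon>)
           {t. \<epsilon> \<le> \<bar>t\<bar> \<and> \<bar>t\<bar> \<le> 1}"
    and "truncated_SW \<psi> lam \<epsilon> =
           integral {\<epsilon>..1} (\<lambda>t. (e t - e (- t)) / complex_of_real t)"
proof -
  let ?f = "\<lambda>t. e t / complex_of_real t"
  have ce: "continuous_on {-1..1} e"
    unfolding e_def by (intro continuous_intros cont)
  have "continuous_on {\<epsilon>..1} ?f" "continuous_on {-1..-\<epsilon>} ?f"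
    using \<epsilon> by (auto intro!: continuous_intros continuous_on_subset[OF ce])
  then have i: "?f integrable_on {\<epsilon>..1}" "?f integrable_on {-1..-\<epsilon>}"
    by (auto intro: integrable_continuous_interval)
  have n: "negligible ({-1..-\<epsilon>} \<inter> {\<epsilon>..1})"
    using \<epsilon> by (simp add: Int_absorb)
  have hu: "(?f has_integral (integral {-1..-\<epsilon>} ?f + integral {\<epsilon>..1} ?f))
             {t. \<epsilon> \<le> \<bar>t\<bar> \<and> \<bar>t\<bar> \<le> 1}"
    unfolding SW_region[OF \<epsilon>(1)]
    by (rule has_integral_Un[OF integrable_integral[OF i(2)] integrable_integral[OF i(1)] n])
  then have eq: "truncated_SW \<psi> lam \<epsilon> = integral {-1..-\<epsilon>} ?f + integral {\<epsilon>..1} ?f"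
    unfolding truncated_SW_def e_def by (rule integral_unique)
  show "(?f has_integral truncated_SW \<psi> lam \<epsilon>) {t. \<epsilon> \<le> \<bar>t\<bar> \<and> \<bar>t\<bar> \<le> 1}"
    using hu eq by simp
  have r: "integral {-1..-\<epsilon>} ?f = integral {\<epsilon>..1} (\<lambda>t. ?f (- t))"
    using Henstock_Kurzweil_Integration.integral_reflect_real
      [where a = \<epsilon> and b = 1 and f = "\<lambda>t. ?f (- t)"]
    by (simp only: minus_minus)
  have i': "(\<lambda>t. ?f (- t)) integrable_on {\<epsilon>..1}"
    using Henstock_Kurzweil_Integration.integrable_reflect_real
      [where a = \<epsilon> and b = 1 and f = "\<lambda>t. ?f (- t)"] i(2)
    by (simp only: minus_minus)
  have "integral {-1..-\<epsilon>} ?f + integral {\<epsilon>..1} ?f = integral {\<epsilon>..1} (\<lambda>t. ?f (-t) + ?f t)"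
    unfolding r by (rule integral_add[OF i' i(1), symmetric])
  also have "\<dots> = integral {\<epsilon>..1} (\<lambda>t. (e t - e (- t)) / complex_of_real t)"
    by (rule arg_cong[where f="integral {\<epsilon>..1}"]) (auto simp: diff_divide_distrib)
  finally show "truncated_SW \<psi> lam \<epsilon> =
      integral {\<epsilon>..1} (\<lambda>t. (e t - e (- t)) / complex_of_real t)"
    using eq by simp
qed

theorem SW_limit_exists:
  assumes "C_diff_on 1 \<psi> {-1..1}"
  shows "(truncated_SW \<psi> lam \<longlongrightarrow> SW_integral \<psi> lam) (at_right 0)"
proof -
  obtain D :: "nat \<Rightarrow> real \<Rightarrow> real" where D0: "D 0 = \<psi>"
    and D: "\<forall>j<1. \<forall>x\<in>{-1..1}. (D j has_real_derivative D (Suc j) x) (at x within {-1..1})"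
    and Dc: "\<forall>j\<le>1. continuous_on {-1..1} (D j)"
    using assms unfolding C_diff_on_def by blast
  have cont: "continuous_on {-1..1} \<psi>" using D0 Dc by auto
  have "(\<psi> has_real_derivative D 1 0) (at 0 within {-1..1})" using D D0 by auto
  then have d: "(\<psi> has_real_derivative D 1 0) (at 0)"
    by (subst (asm) at_within_interior) auto
  define e where "e = (\<lambda>t. exp (\<i> * complex_of_real (lam * \<psi> t)))"
  define c where "c = exp (\<i> * complex_of_real (lam * \<psi> 0)) * (\<i> * complex_of_real (lam * D 1 0))"
  have "((\<lambda>t. lam * \<psi> t) has_real_derivative lam * D 1 0) (at 0)"
    by (rule DERIV_cmult[OF d])
  then have "((\<lambda>t. complex_of_real (lam * \<psi> t)) has_vector_derivative complex_of_real (lam * D 1 0)) (at 0)"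
    by (rule has_vector_derivative_of_real)
  then have v1: "((\<lambda>t. \<i> * complex_of_real (lam * \<psi> t)) has_vector_derivative \<i> * complex_of_real (lam * D 1 0)) (at 0)"
    by (rule has_vector_derivative_mult_right)
  have ed: "(e has_vector_derivative c) (at 0)"
    using field_vector_diff_chain_at[OF v1 DERIV_exp]
    by (simp add: e_def c_def o_def mult.commute)
  have em: "((\<lambda>t. e (- t)) has_vector_derivative - c) (at 0)"
  proof -
    have "((\<lambda>t::real. - t) has_vector_derivative (- 1)) (at 0)"
      by (auto intro!: derivative_eq_intros)
    from vector_diff_chain_at[OF this, of e c] ed show ?thesis by (simp add: o_def)
  qed
  define h where "h = (\<lambda>t::real. if t = 0 then 2 * c else (e t - e (- t)) / complex_of_real t)"
  have "((\<lambda>t. e t - e (- t)) has_vector_derivative 2 * c) (at 0)"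
    using has_vector_derivative_diff[OF ed em] by simp
  then have q: "((\<lambda>t. (e t - e (- t)) / complex_of_real t) \<longlongrightarrow> 2 * c) (at 0)"
    unfolding has_vector_derivative_def has_derivative_at
  proof -
    assume "bounded_linear (\<lambda>x. x *\<^sub>R (2 * c)) \<and>
      (\<lambda>h. norm (e (0 + h) - e (- (0 + h)) - (e 0 - e (- 0)) - h *\<^sub>R (2 * c)) / norm h) \<midarrow>0\<rightarrow> 0"
    then have "(\<lambda>h::real. norm (e h - e (- h) - h *\<^sub>R (2 * c)) / norm h) \<midarrow>0\<rightarrow> 0" by simp
    moreover have "\<forall>\<^sub>F h::real in at 0. norm (e h - e (- h) - h *\<^sub>R (2 * c)) / norm h
        = norm ((e h - e (- h)) / complex_of_real h - 2 * c)"
    proof (rule eventually_at_filter[THEN iffD2], rule always_eventually, intro allI impI)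
      fix h :: real assume "h \<noteq> 0"
      then have "(e h - e (- h)) / complex_of_real h - 2 * c
          = (e h - e (- h) - h *\<^sub>R (2 * c)) / complex_of_real h"
        by (simp add: field_simps scaleR_conv_of_real)
      then show "norm (e h - e (- h) - h *\<^sub>R (2 * c)) / norm h
          = norm ((e h - e (- h)) / complex_of_real h - 2 * c)"
        by (simp add: norm_divide)
    qed
    ultimately have "(\<lambda>h. norm ((e h - e (- h)) / complex_of_real h - 2 * c)) \<midarrow>0\<rightarrow> 0"
      by (rule Lim_transform_eventually)
    then show ?thesis
      by (subst Lim_null, subst tendsto_norm_zero_iff[symmetric])
  qed
  have ce: "continuous_on {-1..1} e"
    unfolding e_def by (intro continuous_intros cont)
  have hc: "continuous_on {0..1} h"
    unfolding continuous_on_def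
  proof
    fix x :: real assume x: "x \<in> {0..1}"
    show "(h \<longlongrightarrow> h x) (at x within {0..1})"
    proof (cases "x = 0")
      case True
      have "((\<lambda>t. (e t - e (- t)) / complex_of_real t) \<longlongrightarrow> 2 * c) (at 0 within {0..1})"
        using q by (rule tendsto_within_subset) auto
      then have "(h \<longlongrightarrow> 2 * c) (at 0 within {0..1})"
        by (rule Lim_transform_eventually) (auto simp: h_def eventually_at_filter)
      then show ?thesis using True by (simp add: h_def)
    next
      case False
      have cm: "continuous_on {0..1} (\<lambda>t. e (- t))"
        by (rule continuous_on_compose2[OF ce]) (auto intro!: continuous_intros)
      have cp: "continuous_on {0..1} e"
        by (rule continuous_on_subset[OF ce]) auto
      have t: "((\<lambda>t. (e t - e (- t)) / complex_of_real t) \<longlongrightarrow> (e x - e (- x)) / complex_of_real x) (at x within {0..1})"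
        using cm cp x False unfolding continuous_on_def
        by (intro tendsto_intros) auto
      have "\<forall>\<^sub>F t in at x within {0..1}. t \<noteq> 0"
        using tendsto_imp_eventually_ne[OF tendsto_ident_at False] .
      then have "\<forall>\<^sub>F t in at x within {0..1}. (e t - e (- t)) / complex_of_real t = h t"
        by eventually_elim (simp add: h_def)
      with t have "(h \<longlongrightarrow> (e x - e (- x)) / complex_of_real x) (at x within {0..1})"
        by (rule Lim_transform_eventually)
      then show ?thesis using False by (simp add: h_def)
    qed
  qed
  have "continuous_on {0..1} (\<lambda>x. integral {x..1} h)"
    by (rule indefinite_integral_continuous_1'[OF integrable_continuous_interval[OF hc]])
  then have "((\<lambda>x. integral {x..1} h) \<longlongrightarrow> integral {0..1} h) (at 0 within {0..1})"
    unfolding continuous_on_def by auto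
  moreover have "at (0::real) within {0..1} = at_right 0"
    by (rule at_within_Icc_at_right) simp
  ultimately have L: "((\<lambda>x. integral {x..1} h) \<longlongrightarrow> integral {0..1} h) (at_right 0)" by simp
  have "\<forall>\<^sub>F x in at_right (0::real). x \<in> {0<..<1}"
    by (rule eventually_at_right_real) simp
  then have "\<forall>\<^sub>F x in at_right 0. integral {x..1} h = truncated_SW \<psi> lam x"
  proof eventually_elim
    case (elim x)
    have "integral {x..1} h = integral {x..1} (\<lambda>t. (e t - e (- t)) / complex_of_real t)"
      by (rule integral_cong) (use elim in \<open>auto simp: h_def\<close>)
    then show ?case
      using truncated_SW_has_integral(2)[OF cont, of x lam] elim by (simp add: e_def)
  qed
  with L have "(truncated_SW \<psi> lam \<longlongrightarrow> integral {0..1} h) (at_right 0)"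
    by (rule Lim_transform_eventually)
  then show ?thesis
    unfolding SW_integral_def by (simp add: tendsto_Lim)
qed

end

theory Submission
  imports Defs
begin

text \<open>
  Write \<open>e(t) = exp (i \<lambda> \<psi>(t))\<close>. Folding the negative half of the line onto the positive one turns the
  truncated integral into the integral of \<open>(e(t) - e(-t)) / t\<close> over \<open>[\<epsilon>, 1]\<close>. The numerator is at most
  \<open>2\<close>, and at most \<open>2 M \<lambda> t\<close> if \<open>\<psi>\<close> has Lipschitz constant \<open>M\<close>. The second bound is the better one
  up to about \<open>t = 1/\<lambda>\<close> and contributes a constant there; the first one contributes \<open>2 ln \<lambda>\<close> on the
  rest. Both are uniform in \<open>\<epsilon>\<close> (\<open>truncated_SW_upper_bound\<close>), so they pass to the principal value.

  The logarithm is attained when \<open>e(t)\<close> oscillates on one side of the origin only, so that nothing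
  cancels the mass of \<open>e(-t) / t\<close> on the other side. Take \<open>\<psi>(t) = t\<^sup>n\<close> for \<open>t > 0\<close> and \<open>\<psi>(t) = 0\<close>
  otherwise; this is \<open>C\<^sup>\<alpha>\<close> for \<open>n = \<alpha> + 1\<close>. Then minus the real part of the integrand is
  \<open>(1 - cos (\<lambda> t\<^sup>n)) / t \<ge> 0\<close>. From \<open>\<lambda> t\<^sup>n = 1\<close> on, the term \<open>1 / t\<close> contributes \<open>(ln \<lambda>) / n\<close>, while
  the cosine term stays bounded by an integration by parts
  (\<open>integral_one_minus_cos_power_ge\<close>).
\<close>

section \<open>The logarithmic upper bound\<close>

lemma norm_exp_i_diff_le:
  "cmod (exp (\<i> * complex_of_real a) - exp (\<i> * complex_of_real b)) \<le> \<bar>a - b\<bar>"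
proof -
  have "exp (\<i> * complex_of_real a) - exp (\<i> * complex_of_real b)
      = exp (\<i> * complex_of_real b) * (exp (\<i> * complex_of_real (a - b)) - 1)"
    by (simp add: algebra_simps flip: exp_add)
  then have "cmod (exp (\<i> * complex_of_real a) - exp (\<i> * complex_of_real b)) = 2 * \<bar>sin ((a - b) / 2)\<bar>"
    using dist_exp_i_1[of "a - b"] by (simp add: norm_mult)
  also have "\<dots> \<le> 2 * \<bar>(a - b) / 2\<bar>"
    by (intro mult_left_mono abs_sin_x_le_abs_x) auto
  finally show ?thesis by simp
qed

lemma C_diff_on_1_imp_lipschitz:
  assumes "C_diff_on 1 \<psi> {-1..1}"
  obtains M where "0 \<le> M"
    "\<And>s t. s \<in> {-1..1} \<Longrightarrow> t \<in> {-1..1} \<Longrightarrow> \<bar>\<psi> s - \<psi> t\<bar> \<le> M * \<bar>s - t\<bar>"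
proof -
  obtain D :: "nat \<Rightarrow> real \<Rightarrow> real" where D0: "D 0 = \<psi>"
    and D: "\<And>x. x \<in> {-1..1} \<Longrightarrow> (\<psi> has_real_derivative D 1 x) (at x within {-1..1})"
    and Dc: "continuous_on {-1..1} (D 1)"
    using assms unfolding C_diff_on_def by auto
  obtain M where M: "\<And>x. x \<in> {-1..1} \<Longrightarrow> \<bar>D 1 x\<bar> \<le> M"
    using continuous_on_compact_bound[OF compact_Icc Dc] by (metis real_norm_def)
  have "\<bar>\<psi> s - \<psi> t\<bar> \<le> M * \<bar>s - t\<bar>" if "s \<in> {-1..1}" "t \<in> {-1..1}" for s t
    using field_differentiable_bound[of "{-1..1}" \<psi> "D 1" M s t] D M that
    by auto
  moreover have "0 \<le> M" using M[of 0] by auto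
  ultimately show ?thesis using that by blast
qed

text \<open>
  The range is split at \<open>1 / lam\<close>, below which the two phases differ by \<open>O(1)\<close> and the Lipschitz
  bound beats the trivial one. The hypothesis \<open>\<epsilon> \<le> 1 / lam\<close> is harmless because \<open>\<epsilon>\<close> tends to zero
  for fixed \<open>lam\<close>.
\<close>

lemma truncated_SW_upper_bound:
  fixes \<psi> :: "real \<Rightarrow> real"
  assumes cont: "continuous_on {-1..1} \<psi>"
    and lip: "\<And>t. t \<in> {0..1} \<Longrightarrow> \<bar>\<psi> t - \<psi> (- t)\<bar> \<le> M * (2 * t)" and M: "0 \<le> M"
    and \<epsilon>: "0 < \<epsilon>" "\<epsilon> \<le> 1 / lam" and lam: "1 \<le> lam"
  shows "cmod (truncated_SW \<psi> lam \<epsilon>) \<le> 2 * M + 2 * ln lam"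
proof -
  define e where "e = (\<lambda>t. exp (\<i> * complex_of_real (lam * \<psi> t)))"
  define h where "h = (\<lambda>t. (e t - e (- t)) / complex_of_real t)"
  have l1: "1 / lam \<le> 1" "0 < 1 / lam" using lam by auto
  have ce: "continuous_on {-1..1} e"
    unfolding e_def by (intro continuous_intros cont)
  have ch: "continuous_on {\<epsilon>..1} h"
    unfolding h_def using \<epsilon>(1)
    by (intro continuous_intros continuous_on_compose2[OF ce]) auto
  have hi: "h integrable_on {a..b}" if "\<epsilon> \<le> a" "b \<le> 1" for a b
    by (intro integrable_continuous_interval continuous_on_subset[OF ch]) (use that in auto)
  have "truncated_SW \<psi> lam \<epsilon> = integral {\<epsilon>..1} h"
    using truncated_SW_has_integral(2)[OF cont, of \<epsilon> lam] \<epsilon> l1 by (simp add: h_def e_def)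
  also have "\<dots> = integral {\<epsilon>..1 / lam} h + integral {1 / lam..1} h"
    using Henstock_Kurzweil_Integration.integral_combine[of \<epsilon> "1 / lam" 1 h] \<epsilon> l1 hi by simp
  also have "cmod \<dots> \<le> cmod (integral {\<epsilon>..1 / lam} h) + cmod (integral {1 / lam..1} h)"
    by (rule norm_triangle_ineq)
  also have "cmod (integral {\<epsilon>..1 / lam} h) \<le> 2 * M"
  proof -
    have "cmod (h t) \<le> 2 * M * lam" if t: "t \<in> {\<epsilon>..1 / lam}" for t
    proof -
      have t': "0 < t" "t \<le> 1" using t \<epsilon>(1) l1(1) unfolding atLeastAtMost_iff by linarith+
      have "cmod (e t - e (- t)) \<le> \<bar>lam * \<psi> t - lam * \<psi> (- t)\<bar>"
        unfolding e_def by (rule norm_exp_i_diff_le)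
      also have "\<dots> = lam * \<bar>\<psi> t - \<psi> (- t)\<bar>"
        using lam by (simp add: abs_mult flip: right_diff_distrib)
      also have "\<dots> \<le> lam * (M * (2 * t))"
        using lip[of t] t' lam by (intro mult_left_mono) auto
      finally show ?thesis
        using t' by (simp add: h_def norm_divide divide_le_eq mult_ac)
    qed
    then have "cmod (integral {\<epsilon>..1 / lam} h) \<le> 2 * M * lam * (1 / lam - \<epsilon>)"
      using \<epsilon>(2) l1 by (intro integral_bound continuous_on_subset[OF ch]) auto
    also have "\<dots> \<le> 2 * M * lam * (1 / lam)"
      using M lam \<epsilon> by (intro mult_left_mono) auto
    also have "\<dots> = 2 * M" using lam by simp
    finally show ?thesis .
  qed
  also have "cmod (integral {1 / lam..1} h) \<le> 2 * ln lam"
  proof -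
    have pos: "0 < t" if "t \<in> {1 / lam..1}" for t
      using that l1(2) unfolding atLeastAtMost_iff by linarith
    have "((\<lambda>t. 2 / t) has_integral 2 * ln 1 - 2 * ln (1 / lam)) {1 / lam..1}"
      using l1(1) by (intro fundamental_theorem_of_calculus)
        (auto intro!: derivative_eq_intros dest!: pos[simplified]
              simp flip: has_real_derivative_iff_has_vector_derivative)
    then have I: "((\<lambda>t. 2 / t) has_integral 2 * ln lam) {1 / lam..1}"
      using lam by (simp add: ln_div)
    have "cmod (h t) \<le> 2 / t" if t: "t \<in> {1 / lam..1}" for t
    proof -
      have "0 < t" using t by (rule pos)
      moreover have "cmod (e t - e (- t)) \<le> 2"
        using norm_triangle_ineq4[of "e t" "e (- t)"] by (simp add: e_def)
      ultimately show ?thesis by (simp add: h_def norm_divide divide_right_mono)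
    qed
    then have "cmod (integral {1 / lam..1} h) \<le> integral {1 / lam..1} (\<lambda>t. 2 / t)"
      using hi[of "1 / lam" 1] \<epsilon> I by (intro integral_norm_bound_integral) auto
    then show ?thesis using I by (simp add: integral_unique)
  qed
  finally show ?thesis by simp
qed

lemma SW_integral_bigo_ln:
  assumes "C_diff_on 1 \<psi> {-1..1}"
  shows "SW_integral \<psi> \<in> O[at_top](\<lambda>lam. complex_of_real (ln lam))"
proof -
  obtain M where M: "0 \<le> M"
    and lip: "\<And>s t. s \<in> {-1..1} \<Longrightarrow> t \<in> {-1..1} \<Longrightarrow> \<bar>\<psi> s - \<psi> t\<bar> \<le> M * \<bar>s - t\<bar>"
    using C_diff_on_1_imp_lipschitz[OF assms] by blast
  have cont: "continuous_on {-1..1} \<psi>"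
    using assms unfolding C_diff_on_def by auto
  have bound: "cmod (SW_integral \<psi> lam) \<le> 2 * M + 2 * ln lam" if lam: "1 \<le> lam" for lam
  proof (rule tendsto_upperbound)
    show "((\<lambda>\<epsilon>. cmod (truncated_SW \<psi> lam \<epsilon>)) \<longlongrightarrow> cmod (SW_integral \<psi> lam)) (at_right 0)"
      by (rule tendsto_norm[OF SW_limit_exists[OF assms]])
    have "\<forall>\<^sub>F \<epsilon> in at_right (0::real). \<epsilon> \<in> {0<..<1 / lam}"
      using lam by (intro eventually_at_right_real) auto
    then show "\<forall>\<^sub>F \<epsilon> in at_right 0. cmod (truncated_SW \<psi> lam \<epsilon>) \<le> 2 * M + 2 * ln lam"
    proof eventually_elim
      case (elim \<epsilon>)
      have "\<bar>\<psi> t - \<psi> (- t)\<bar> \<le> M * (2 * t)" if "t \<in> {0..1}" for t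
        using lip[of t "- t"] that by simp
      then show ?case
        using truncated_SW_upper_bound[OF cont _ M] elim lam by simp
    qed
  qed simp
  show ?thesis
  proof (rule bigoI)
    show "\<forall>\<^sub>F lam in at_top. cmod (SW_integral \<psi> lam) \<le> (2 * M + 2) * cmod (complex_of_real (ln lam))"
      using eventually_ge_at_top[of "exp 1"]
    proof eventually_elim
      case (elim lam)
      have lam: "1 \<le> lam" using elim exp_ge_add_one_self[of 1] by linarith
      \<comment> \<open>From here on the constant \<open>2 * M\<close> is absorbed by the logarithm.\<close>
      have ln: "1 \<le> ln lam" using elim lam by (simp add: ln_ge_iff)
      have "2 * M * 1 \<le> 2 * M * ln lam" using M ln by (intro mult_left_mono) auto
      then show ?case using bound[OF lam] ln by (simp add: algebra_simps)
    qed
  qed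
qed

section \<open>A one-sided power as extremal phase\<close>

lemma has_real_derivative_pos_part_power:
  assumes "2 \<le> m"
  shows "((\<lambda>t. max 0 t ^ m) has_real_derivative real m * max 0 x ^ (m - 1)) (at x)"
proof -
  consider "x > 0" | "x < 0" | "x = 0" by linarith
  then show ?thesis
  proof cases
    case 1
    have "((\<lambda>t. t ^ m) has_real_derivative real m * max 0 x ^ (m - 1)) (at x)"
      using 1 by (auto intro!: derivative_eq_intros)
    moreover have "\<forall>\<^sub>F t in nhds x. max 0 t ^ m = t ^ m"
      using eventually_nhds_in_open[of "{0<..}" x] 1 by (auto elim: eventually_mono)
    ultimately show ?thesis by (subst DERIV_cong_ev[OF refl _ refl]) auto
  next
    case 2
    have "((\<lambda>t. 0) has_real_derivative real m * max 0 x ^ (m - 1)) (at x)"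
      using 2 assms by (auto simp: zero_power)
    moreover have "\<forall>\<^sub>F t in nhds x. max 0 t ^ m = 0"
      using eventually_nhds_in_open[of "{..<0}" x] 2 assms by (auto elim: eventually_mono)
    ultimately show ?thesis by (subst DERIV_cong_ev[OF refl _ refl]) auto
  next
    case 3
    \<comment> \<open>Caratheodory's criterion: the difference quotient at the origin is the continuous function
      \<open>max 0 z ^ (m - 1)\<close>, which vanishes there because \<open>2 \<le> m\<close>.\<close>
    have "max 0 z ^ m = max 0 z ^ (m - 1) * z" for z :: real
      using assms by (cases "z \<le> 0"; cases m) auto
    moreover have "isCont (\<lambda>z::real. max 0 z ^ (m - 1)) 0"
      by (intro continuous_intros)
    ultimately show ?thesis
      unfolding DERIV_caratheodory_within 3 using assms
      by (intro exI[of _ "\<lambda>z. max 0 z ^ (m - 1)"]) auto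
  qed
qed

text \<open>
  Each of the first \<open>k\<close> differentiations lowers the exponent by one and acts on an exponent of at
  least two, so the \<open>k\<close>-th derivative is a multiple of the continuous function \<open>max 0 t\<close>.
\<close>

lemma C_diff_on_pos_part_power:
  "C_diff_on k (\<lambda>t. max 0 t ^ Suc k) S"
proof -
  define D :: "nat \<Rightarrow> real \<Rightarrow> real" where
    "D = (\<lambda>j t. (fact (Suc k) / fact (Suc k - j)) * max 0 t ^ (Suc k - j))"
  have "(D j has_real_derivative D (Suc j) x) (at x within S)" if "j < k" for j x
  proof -
    have m: "Suc k - j = Suc (k - j)" "k - j \<ge> 1" using that by auto
    have "(D j has_real_derivative fact (Suc k) / fact (Suc k - j) *
        (real (Suc k - j) * max 0 x ^ (Suc k - j - 1))) (at x within S)"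
      unfolding D_def using that
      by (intro DERIV_cmult has_field_derivative_at_within[OF has_real_derivative_pos_part_power]) auto
    also have "fact (Suc k) / fact (Suc k - j) * (real (Suc k - j) * max 0 x ^ (Suc k - j - 1))
        = D (Suc j) x"
      unfolding D_def m(1) fact_Suc[of "k - j"] by (simp del: fact_Suc of_nat_Suc)
    finally show ?thesis .
  qed
  moreover have "continuous_on S (D j)" for j
    unfolding D_def by (intro continuous_intros)
  moreover have "D 0 = (\<lambda>t. max 0 t ^ Suc k)" by (simp add: D_def del: fact_Suc)
  ultimately show ?thesis unfolding C_diff_on_def by blast
qed

text \<open>
  In the variable \<open>u = lam * t ^ n\<close> the integral is \<open>1 / n\<close> times that of \<open>(1 - cos u) / u\<close> over
  \<open>[1, lam]\<close>. Integrating \<open>cos u / u\<close> by parts leaves the remainder \<open>sin u / u\<^sup>2\<close>; estimating it by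
  \<open>1 / u\<^sup>2\<close> makes everything explicit, since \<open>ln u - sin u / u + 1 / u\<close> then has a derivative
  \<open>\<le> (1 - cos u) / u\<close>. The proof uses this function, composed with \<open>lam * t ^ n\<close>, as a minorising
  antiderivative, so that no substitution in the integral is needed.
\<close>

lemma integral_one_minus_cos_power_ge:
  fixes lam :: real
  assumes n: "0 < n" and lam: "1 \<le> lam" and d: "0 < d" "d \<le> 1" "lam * d ^ n = 1"
  shows "(ln lam - 2) / n \<le> integral {d..1} (\<lambda>t. (1 - cos (lam * t ^ n)) / t)"
proof -
  define F where "F = (\<lambda>u::real. ln u - sin u / u + 1 / u)"
  define F' where "F' = (\<lambda>u::real. 1 / u - (cos u / u - sin u / u^2) - 1 / u^2)"
  define G' where "G' = (\<lambda>t. F' (lam * t ^ n) * (lam * t ^ (n - 1)))"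
  have F: "(F has_real_derivative F' u) (at u)" if "u > 0" for u
    unfolding F_def F'_def using that
    by (auto intro!: derivative_eq_intros simp: field_simps power2_eq_square)
  have "((\<lambda>t. F (lam * t ^ n) / n) has_real_derivative G' t) (at t)" if "t > 0" for t
  proof -
    have "((\<lambda>t. lam * t ^ n) has_real_derivative n * (lam * t ^ (n - 1))) (at t)"
      by (auto intro!: derivative_eq_intros)
    from DERIV_chain2[OF F this] have "((\<lambda>t. F (lam * t ^ n)) has_real_derivative
        F' (lam * t ^ n) * (n * (lam * t ^ (n - 1)))) (at t)"
      using that lam by simp
    from DERIV_cdivide[OF this, of n] show ?thesis using n by (simp add: G'_def)
  qed
  then have I: "(G' has_integral F (lam * 1 ^ n) / n - F (lam * d ^ n) / n) {d..1}"
    using d by (intro fundamental_theorem_of_calculus)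
      (auto simp flip: has_real_derivative_iff_has_vector_derivative
            intro: has_field_derivative_at_within)
  have "G' t \<le> (1 - cos (lam * t ^ n)) / t" if t: "t \<in> {d..1}" for t
  proof -
    define u where "u = lam * t ^ n"
    have t0: "t > 0" using t d by auto
    have u0: "u > 0" using t0 lam by (simp add: u_def)
    have w: "lam * t ^ (n - 1) = u / t"
      using n t0 by (cases n) (auto simp: u_def)
    have "F' u \<le> (1 - cos u) / u"
      using u0 by (simp add: F'_def field_simps power2_eq_square)
    then have "F' u * (u / t) \<le> (1 - cos u) / u * (u / t)"
      using u0 t0 by (intro mult_right_mono) auto
    then show ?thesis using u0 w by (simp add: G'_def flip: u_def)
  qed
  moreover have "(\<lambda>t. (1 - cos (lam * t ^ n)) / t) integrable_on {d..1}"
    using d by (intro integrable_continuous_interval continuous_intros) auto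
  ultimately have "F (lam * 1 ^ n) / n - F (lam * d ^ n) / n
      \<le> integral {d..1} (\<lambda>t. (1 - cos (lam * t ^ n)) / t)"
    using I by (intro has_integral_le[OF I integrable_integral]) auto
  moreover have "F lam - F 1 \<ge> ln lam - 2"
  proof -
    have "sin lam / lam \<le> 1 / lam" using lam by (intro divide_right_mono) auto
    moreover have "F lam - F 1 = ln lam - sin lam / lam + 1 / lam + sin 1 - 1"
      by (simp add: F_def)
    ultimately show ?thesis using sin_ge_minus_one[of 1] by linarith
  qed
  then have "F lam / n - F 1 / n \<ge> (ln lam - 2) / n"
    by (simp add: divide_right_mono flip: diff_divide_distrib)
  ultimately show ?thesis using d by simp
qed

text \<open>
  The real part of the folded integrand has constant sign, so the piece over \<open>[\<epsilon>, d]\<close> may be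
  discarded. This gives a bound independent of \<open>\<epsilon>\<close>, which survives the limit.
\<close>

lemma truncated_SW_pos_part_power_lower_bound:
  assumes n: "0 < n" and lam: "1 \<le> lam"
    and d: "0 < d" "d \<le> 1" "lam * d ^ n = 1" and \<epsilon>: "0 < \<epsilon>" "\<epsilon> \<le> d"
  shows "(ln lam - 2) / n \<le> cmod (truncated_SW (\<lambda>t. max 0 t ^ n) lam \<epsilon>)"
proof -
  define e where "e = (\<lambda>t. exp (\<i> * complex_of_real (lam * max 0 t ^ n)))"
  define f where "f = (\<lambda>t. (1 - cos (lam * t ^ n)) / t)"
  have cont: "continuous_on {-1..1} (\<lambda>t::real. max 0 t ^ n)"
    by (intro continuous_intros)
  have ci: "(\<lambda>t. (e t - e (- t)) / complex_of_real t) integrable_on {\<epsilon>..1}"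
    unfolding e_def using \<epsilon> by (intro integrable_continuous_interval continuous_intros) auto
  have fi: "f integrable_on {a..1}" if "a > 0" for a
    unfolding f_def using that by (intro integrable_continuous_interval continuous_intros) auto
  have "- Re (truncated_SW (\<lambda>t. max 0 t ^ n) lam \<epsilon>)
      = integral {\<epsilon>..1} (\<lambda>t. - Re ((e t - e (- t)) / complex_of_real t))"
    using truncated_SW_has_integral(2)[OF cont, of \<epsilon> lam] \<epsilon> d
      integral_linear[OF ci bounded_linear_Re]
    by (simp add: e_def o_def)
  also have "\<dots> = integral {\<epsilon>..1} f"
    using \<epsilon> n by (intro integral_cong) (auto simp: e_def f_def Re_exp diff_divide_distrib zero_power)
  also have "\<dots> \<ge> integral {d..1} f"
    using \<epsilon> d by (intro integral_subset_le fi) (auto simp: f_def)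
  finally have "integral {d..1} f \<le> - Re (truncated_SW (\<lambda>t. max 0 t ^ n) lam \<epsilon>)" .
  moreover have "(ln lam - 2) / n \<le> integral {d..1} f"
    unfolding f_def by (rule integral_one_minus_cos_power_ge[OF n lam d])
  ultimately show ?thesis
    using abs_Re_le_cmod[of "truncated_SW (\<lambda>t. max 0 t ^ n) lam \<epsilon>"] by linarith
qed

lemma SW_integral_pos_part_power_lower_bound:
  assumes n: "2 \<le> n" and lam: "1 \<le> lam"
  shows "(ln lam - 2) / n \<le> cmod (SW_integral (\<lambda>t. max 0 t ^ n) lam)"
proof (rule tendsto_lowerbound)
  have "C_diff_on (n - 1) (\<lambda>t. max 0 t ^ n) {-1..1}"
    using C_diff_on_pos_part_power[of "n - 1" "{-1..1}"] n by simp
  then have "C_diff_on 1 (\<lambda>t. max 0 t ^ n) {-1..1}"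
    using C_diff_on_mono n by simp
  then show "((\<lambda>\<epsilon>. cmod (truncated_SW (\<lambda>t. max 0 t ^ n) lam \<epsilon>)) \<longlongrightarrow>
      cmod (SW_integral (\<lambda>t. max 0 t ^ n) lam)) (at_right 0)"
    by (intro tendsto_norm SW_limit_exists)
  define d where "d = root n (1 / lam)"
  have d: "0 < d" "d \<le> 1" "lam * d ^ n = 1"
    using n lam by (auto simp: d_def real_root_pow_pos2)
  have "\<forall>\<^sub>F \<epsilon> in at_right (0::real). \<epsilon> \<in> {0<..<d}"
    using d by (intro eventually_at_right_real)
  then show "\<forall>\<^sub>F \<epsilon> in at_right 0. (ln lam - 2) / n \<le> cmod (truncated_SW (\<lambda>t. max 0 t ^ n) lam \<epsilon>)"
  proof eventually_elim
    case (elim \<epsilon>)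
    have "0 < n" using n by simp
    from truncated_SW_pos_part_power_lower_bound[OF this lam d, of \<epsilon>] elim show ?case
      by simp
  qed
qed simp

theorem proposition1p1:
  fixes \<alpha> :: nat
  assumes "\<alpha> \<ge> 1"
  shows "(\<forall>\<psi> :: real \<Rightarrow> real. C_diff_on \<alpha> \<psi> {-1..1} \<longrightarrow>
            SW_integral \<psi> \<in> O[at_top](\<lambda>lam. complex_of_real (ln lam))) \<and>
         (\<exists>\<psi> :: real \<Rightarrow> real. C_diff_on \<alpha> \<psi> {-1..1} \<and>
            (\<exists>c>0. \<exists>C>0. \<forall>\<^sub>F lam in at_top.
               c * ln lam \<le> cmod (SW_integral \<psi> lam) \<and> cmod (SW_integral \<psi> lam) \<le> C * ln lam))"
proof (intro conjI allI impI)
  fix \<psi> :: "real \<Rightarrow> real"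
  assume "C_diff_on \<alpha> \<psi> {-1..1}"
  then show "SW_integral \<psi> \<in> O[at_top](\<lambda>lam. complex_of_real (ln lam))"
    using SW_integral_bigo_ln C_diff_on_mono assms by blast
next
  define n where "n = Suc \<alpha>"
  define \<psi> :: "real \<Rightarrow> real" where "\<psi> = (\<lambda>t. max 0 t ^ n)"
  have n: "2 \<le> n" using assms by (simp add: n_def)
  have smooth: "C_diff_on \<alpha> \<psi> {-1..1}"
    unfolding \<psi>_def n_def by (rule C_diff_on_pos_part_power)
  then have "SW_integral \<psi> \<in> O[at_top](\<lambda>lam. complex_of_real (ln lam))"
    using SW_integral_bigo_ln C_diff_on_mono assms by blast
  then obtain C where C: "C > 0"
    and up: "\<forall>\<^sub>F lam in at_top. cmod (SW_integral \<psi> lam) \<le> C * cmod (complex_of_real (ln lam))"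
    by (elim landau_o.bigE)
  have "\<forall>\<^sub>F lam in at_top. 1 / (2 * n) * ln lam \<le> cmod (SW_integral \<psi> lam) \<and>
      cmod (SW_integral \<psi> lam) \<le> C * ln lam"
    using up eventually_ge_at_top[of "exp 4"]
  proof eventually_elim
    case (elim lam)
    have lam: "1 \<le> lam" using elim(2) exp_ge_add_one_self[of 4] by linarith
    \<comment> \<open>For \<open>ln lam \<ge> 4\<close> half of the logarithm absorbs the constant \<open>2\<close> of the lower bound.\<close>
    have ln: "4 \<le> ln lam" using elim(2) lam by (simp add: ln_ge_iff)
    have "1 / (2 * n) * ln lam = (ln lam / 2) / n" by simp
    also have "\<dots> \<le> (ln lam - 2) / n" using ln by (intro divide_right_mono) auto
    also have "\<dots> \<le> cmod (SW_integral \<psi> lam)"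
      unfolding \<psi>_def by (rule SW_integral_pos_part_power_lower_bound[OF n lam])
    finally show ?case using elim(1) ln by simp
  qed
  moreover have "0 < 1 / (2 * real n)" using n by simp
  ultimately show "\<exists>\<psi>. C_diff_on \<alpha> \<psi> {-1..1} \<and> (\<exists>c>0. \<exists>C>0. \<forall>\<^sub>F lam in at_top.
      c * ln lam \<le> cmod (SW_integral \<psi> lam) \<and> cmod (SW_integral \<psi> lam) \<le> C * ln lam)"
    using smooth C
    by (intro exI[of _ \<psi>] conjI exI[of _ "1 / (2 * real n)"] exI[of _ C]) simp_all
qed

end
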